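(* Consider the LRCD scheme (Steps 1–3 in the context). There exist unique $\{U^{1/2},V^{1/2}\}\in\mathbb C_h^p\times\mathbb C_h^p$ and $\{\Phi^{1/2},\Psi^{1/2}\}\in\mathbb R_h^p\times\mathbb R_h^p$ satisfying equations (1a), (1b), (2a); unique $\{U^1,V^1\}\in\mathbb C_h^p\times\mathbb C_h^p$ satisfying (2b), (2c); and, for each $1\le n\le N-1$, unique $\{U^{n+1},V^{n+1}\}\in\mathbb C_h^p\times\mathbb C_h^p$ and $\{\Phi^{n+1/2},\Psi^{n+1/2}\}\in\mathbb R_h^p\times\mathbb R_h^p$ satisfying (3a), (3b), (3c).
   Context: **Grids.** $\Omega=(x_l,x_r)\times(y_l,y_r)$, $T>0$, $\kappa,\beta\in\mathbb R$ constants. For positive integers $N,M_x,M_y$: $\tau=T/N$, $h_x=(x_r-x_l)/M_x$, $h_y=(y_r-y_l)/M_y$, grid points $(x_l+ih_x,y_l+jh_y)$. $\mathbb C_h^p$ (resp. $\mathbb R_h^p$) is the space of complex (resp. real) grid functions $\{w_{i,j}\}_{0\le i\le M_x,0\le j\le M_y}$ with $w_{0,j}=w_{M_x,j}$, $w_{i,0}=w_{i,M_y}$, extended periodically in the indices. Products and $|\cdot|^2$ are pointwise. $\widetilde w^{n+1/2}=\frac{w^{n+1}+w^n}{2}$, $\delta_tw^{n+1}=\frac{w^{n+1}-w^n}{\tau}$. **Operators.** $\delta_x^2w_{i,j}=\frac{w_{i+1,j}-2w_{i,j}+w_{i-1,j}}{h_x^2}$, $\mathcal A_xw_{i,j}=w_{i,j}+\frac{h_x^2}{12}\delta_x^2w_{i,j}$,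 similarly in $y$; $\mathcal A_h=\mathcal A_x\mathcal A_y$, $\Lambda_h=\mathcal A_y\delta_x^2+\mathcal A_x\delta_y^2$. **LRCD scheme** (for the coupled nonlinear Schrödinger system with periodic initial data $u^0,v^0$). Initial values $U^0=u^0$, $V^0=v^0$ (grid values), $\Phi^0=|u^0|^2$, $\Psi^0=|v^0|^2$. Step 1: find $\{U^{1/2},V^{1/2}\}\in\mathbb C_h^p\times\mathbb C_h^p$ with (1a) $\mathrm i\mathcal A_h\frac{U^{1/2}-U^0}{\tau/2}+\kappa\Lambda_h\frac{U^{1/2}+U^0}{2}+\mathcal A_h\big[(\Phi^0+\beta\Psi^0)\frac{U^{1/2}+U^0}{2}\big]=0$, (1b) $\mathrm i\mathcal A_h\frac{V^{1/2}-V^0}{\tau/2}+\kappa\Lambda_h\frac{V^{1/2}+V^0}{2}+\mathcal A_h\big[(\Psi^0+\beta\Phi^0)\frac{V^{1/2}+V^0}{2}\big]=0$. Step 2: (2a) $\Phi^{1/2}=|U^{1/2}|^2$, $\Psi^{1/2}=|V^{1/2}|^2$; then find $\{U^1,V^1\}\in\mathbb C_h^p\times\mathbb C_h^p$ with (2b) $\mathrm i\mathcal A_h\delta_tU^1+\kappa\Lambda_h\widetilde U^{1/2}+\mathcal A_h[(\Phi^{1/2}+\beta\Psi^{1/2})\widetilde U^{1/2}]=0$, (2c) $\mathrm i\mathcal A_h\delta_tV^1+\kappa\Lambda_h\widetilde V^{1/2}+\mathcal A_h[(\Psi^{1/2}+\beta\Phi^{1/2})\widetilde V^{1/2}]=0$,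 where $\widetilde U^{1/2}=\frac{U^1+U^0}{2}$, $\widetilde V^{1/2}=\frac{V^1+V^0}{2}$. Step 3: for $n=1,\dots,N-1$, (3a) $\Phi^{n+1/2}=2|U^n|^2-\Phi^{n-1/2}$, $\Psi^{n+1/2}=2|V^n|^2-\Psi^{n-1/2}$, then find $\{U^{n+1},V^{n+1}\}\in\mathbb C_h^p\times\mathbb C_h^p$ with (3b) $\mathrm i\mathcal A_h\delta_tU^{n+1}+\kappa\Lambda_h\widetilde U^{n+1/2}+\mathcal A_h[(\Phi^{n+1/2}+\beta\Psi^{n+1/2})\widetilde U^{n+1/2}]=0$, (3c) $\mathrm i\mathcal A_h\delta_tV^{n+1}+\kappa\Lambda_h\widetilde V^{n+1/2}+\mathcal A_h[(\Psi^{n+1/2}+\beta\Phi^{n+1/2})\widetilde V^{n+1/2}]=0$. *)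

theory Defs
  imports Complex_Main
begin

text \<open>Grid functions, extended periodically, are functions on pairs of integers; the spaces
  \<open>\<complex>_h^p\<close> and \<open>\<real>_h^p\<close> are the instances of \<open>per_grid\<close> at types \<open>complex\<close> and \<open>real\<close>.\<close>

type_synonym 'a grid = "int \<Rightarrow> int \<Rightarrow> 'a"

definition per_grid :: "nat \<Rightarrow> nat \<Rightarrow> 'a grid set" where
  "per_grid Mx My = {w. \<forall>i j. w (i + int Mx) j = w i j \<and> w i (j + int My) = w i j}"

definition grid_values ::
    "real \<Rightarrow> real \<Rightarrow> real \<Rightarrow> real \<Rightarrow> (real \<Rightarrow> real \<Rightarrow> complex) \<Rightarrow> complex grid" where
  "grid_values xl yl hx hy u = (\<lambda>i j. u (xl + of_int i * hx) (yl + of_int j * hy))"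

definition delta2_x :: "real \<Rightarrow> complex grid \<Rightarrow> complex grid" where
  "delta2_x hx w = (\<lambda>i j. (w (i + 1) j - 2 * w i j + w (i - 1) j) / of_real (hx ^ 2))"

definition delta2_y :: "real \<Rightarrow> complex grid \<Rightarrow> complex grid" where
  "delta2_y hy w = (\<lambda>i j. (w i (j + 1) - 2 * w i j + w i (j - 1)) / of_real (hy ^ 2))"

definition A_x :: "real \<Rightarrow> complex grid \<Rightarrow> complex grid" where
  "A_x hx w = (\<lambda>i j. w i j + of_real (hx ^ 2 / 12) * delta2_x hx w i j)"

definition A_y :: "real \<Rightarrow> complex grid \<Rightarrow> complex grid" where
  "A_y hy w = (\<lambda>i j. w i j + of_real (hy ^ 2 / 12) * delta2_y hy w i j)"

definition A_h :: "real \<Rightarrow> real \<Rightarrow> complex grid \<Rightarrow> complex grid" where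
  "A_h hx hy w = A_x hx (A_y hy w)"

definition Lambda_h :: "real \<Rightarrow> real \<Rightarrow> complex grid \<Rightarrow> complex grid" where
  "Lambda_h hx hy w = (\<lambda>i j. A_y hy (delta2_x hx w) i j + A_x hx (delta2_y hy w) i j)"

definition abs_sq :: "complex grid \<Rightarrow> real grid" where
  "abs_sq w = (\<lambda>i j. (cmod (w i j))\<^sup>2)"

text \<open>One Crank-Nicolson equation, leading from \<open>W\<close> to \<open>W'\<close> over a time step of length \<open>s\<close>,
  with the real potential \<open>G\<close>:
  \<open>\<i> A_h ((W' - W) / s) + \<kappa> \<Lambda>_h ((W' + W) / 2) + A_h (G (W' + W) / 2) = 0\<close>.\<close>

definition cn_eq ::
    "real \<Rightarrow> real \<Rightarrow> real \<Rightarrow> real \<Rightarrow> real grid \<Rightarrow> complex grid \<Rightarrow> complex grid \<Rightarrow> bool" where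
  "cn_eq hx hy \<kappa> s G W W' \<longleftrightarrow>
     (\<forall>i j. \<i> * A_h hx hy (\<lambda>k l. (W' k l - W k l) / of_real s) i j
          + of_real \<kappa> * Lambda_h hx hy (\<lambda>k l. (W' k l + W k l) / 2) i j
          + A_h hx hy (\<lambda>k l. of_real (G k l) * ((W' k l + W k l) / 2)) i j = 0)"

text \<open>The coupled pair of equations: the first component sees the potential \<open>\<Phi> + \<beta> \<Psi>\<close>, the
  second \<open>\<Psi> + \<beta> \<Phi>\<close>.\<close>

definition cn_pair ::
    "real \<Rightarrow> real \<Rightarrow> real \<Rightarrow> real \<Rightarrow> real \<Rightarrow> real grid \<Rightarrow> real grid \<Rightarrow>
     complex grid \<Rightarrow> complex grid \<Rightarrow> complex grid \<Rightarrow> complex grid \<Rightarrow> bool" where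
  "cn_pair hx hy \<kappa> \<beta> s \<Phi> \<Psi> U V U' V' \<longleftrightarrow>
     cn_eq hx hy \<kappa> s (\<lambda>i j. \<Phi> i j + \<beta> * \<Psi> i j) U U' \<and>
     cn_eq hx hy \<kappa> s (\<lambda>i j. \<Psi> i j + \<beta> * \<Phi> i j) V V'"

text \<open>Step 1 together with the definition of \<open>\<Phi>^{1/2}, \<Psi>^{1/2}\<close>; the step length is \<open>\<tau> / 2\<close>
  and \<open>\<Phi>^0 = |U^0|^2\<close>, \<open>\<Psi>^0 = |V^0|^2\<close>.\<close>

definition lrcd_step1 ::
    "nat \<Rightarrow> nat \<Rightarrow> real \<Rightarrow> real \<Rightarrow> real \<Rightarrow> real \<Rightarrow> real \<Rightarrow> complex grid \<Rightarrow> complex grid \<Rightarrow>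
     complex grid \<Rightarrow> complex grid \<Rightarrow> real grid \<Rightarrow> real grid \<Rightarrow> bool" where
  "lrcd_step1 Mx My hx hy \<tau> \<kappa> \<beta> U0 V0 Uh Vh \<Phi>h \<Psi>h \<longleftrightarrow>
     Uh \<in> per_grid Mx My \<and> Vh \<in> per_grid Mx My \<and>
     \<Phi>h \<in> per_grid Mx My \<and> \<Psi>h \<in> per_grid Mx My \<and>
     cn_pair hx hy \<kappa> \<beta> (\<tau> / 2) (abs_sq U0) (abs_sq V0) U0 V0 Uh Vh \<and>
     \<Phi>h = abs_sq Uh \<and> \<Psi>h = abs_sq Vh"

definition lrcd_step2 ::
    "nat \<Rightarrow> nat \<Rightarrow> real \<Rightarrow> real \<Rightarrow> real \<Rightarrow> real \<Rightarrow> real \<Rightarrow> complex grid \<Rightarrow> complex grid \<Rightarrow>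
     real grid \<Rightarrow> real grid \<Rightarrow> complex grid \<Rightarrow> complex grid \<Rightarrow> bool" where
  "lrcd_step2 Mx My hx hy \<tau> \<kappa> \<beta> U0 V0 \<Phi>h \<Psi>h U1 V1 \<longleftrightarrow>
     U1 \<in> per_grid Mx My \<and> V1 \<in> per_grid Mx My \<and>
     cn_pair hx hy \<kappa> \<beta> \<tau> \<Phi>h \<Psi>h U0 V0 U1 V1"

text \<open>Step 3, from \<open>U^n, V^n, \<Phi>^{n-1/2}, \<Psi>^{n-1/2}\<close> (unprimed) to
  \<open>U^{n+1}, V^{n+1}, \<Phi>^{n+1/2}, \<Psi>^{n+1/2}\<close> (primed).\<close>

definition lrcd_step3 ::
    "nat \<Rightarrow> nat \<Rightarrow> real \<Rightarrow> real \<Rightarrow> real \<Rightarrow> real \<Rightarrow> real \<Rightarrow>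
     complex grid \<Rightarrow> complex grid \<Rightarrow> real grid \<Rightarrow> real grid \<Rightarrow>
     complex grid \<Rightarrow> complex grid \<Rightarrow> real grid \<Rightarrow> real grid \<Rightarrow> bool" where
  "lrcd_step3 Mx My hx hy \<tau> \<kappa> \<beta> U V \<Phi> \<Psi> U' V' \<Phi>' \<Psi>' \<longleftrightarrow>
     U' \<in> per_grid Mx My \<and> V' \<in> per_grid Mx My \<and>
     \<Phi>' \<in> per_grid Mx My \<and> \<Psi>' \<in> per_grid Mx My \<and>
     \<Phi>' = (\<lambda>i j. 2 * abs_sq U i j - \<Phi> i j) \<and>
     \<Psi>' = (\<lambda>i j. 2 * abs_sq V i j - \<Psi> i j) \<and>
     cn_pair hx hy \<kappa> \<beta> \<tau> \<Phi>' \<Psi>' U V U' V'"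

text \<open>The scheme run up to time level \<open>n \<ge> 1\<close>.  \<open>U k\<close>, \<open>V k\<close> stand for \<open>U^k\<close>, \<open>V^k\<close>, whereas
  \<open>\<Phi> k\<close>, \<open>\<Psi> k\<close> stand for \<open>\<Phi>^{k+1/2}\<close>, \<open>\<Psi>^{k+1/2}\<close>; \<open>Uh\<close>, \<open>Vh\<close> are \<open>U^{1/2}\<close>, \<open>V^{1/2}\<close>.
  Entries \<open>U k\<close> with \<open>k > n\<close> and \<open>\<Phi> k\<close> with \<open>k \<ge> n\<close> (likewise \<open>V\<close>, \<open>\<Psi>\<close>) are
  unconstrained.\<close>

definition lrcd_upto ::
    "nat \<Rightarrow> nat \<Rightarrow> nat \<Rightarrow> real \<Rightarrow> real \<Rightarrow> real \<Rightarrow> real \<Rightarrow> real \<Rightarrow> complex grid \<Rightarrow> complex grid \<Rightarrow>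
     complex grid \<Rightarrow> complex grid \<Rightarrow> (nat \<Rightarrow> complex grid) \<Rightarrow> (nat \<Rightarrow> complex grid) \<Rightarrow>
     (nat \<Rightarrow> real grid) \<Rightarrow> (nat \<Rightarrow> real grid) \<Rightarrow> bool" where
  "lrcd_upto n Mx My hx hy \<tau> \<kappa> \<beta> U0 V0 Uh Vh U V \<Phi> \<Psi> \<longleftrightarrow>
     U 0 = U0 \<and> V 0 = V0 \<and>
     lrcd_step1 Mx My hx hy \<tau> \<kappa> \<beta> U0 V0 Uh Vh (\<Phi> 0) (\<Psi> 0) \<and>
     lrcd_step2 Mx My hx hy \<tau> \<kappa> \<beta> U0 V0 (\<Phi> 0) (\<Psi> 0) (U 1) (V 1) \<and>
     (\<forall>m. 1 \<le> m \<and> m < n \<longrightarrow>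
        lrcd_step3 Mx My hx hy \<tau> \<kappa> \<beta> (U m) (V m) (\<Phi> (m - 1)) (\<Psi> (m - 1))
          (U (m + 1)) (V (m + 1)) (\<Phi> m) (\<Psi> m))"

end

theory Submission
  imports Defs "HOL-Library.Function_Algebras"
begin

text \<open>Each Crank--Nicolson equation is a square linear system for \<open>X = W' + W\<close>, so only its kernel
  matters.  \<open>A_h\<close> is self-adjoint, injective (it is diagonally dominant), hence invertible on periodic
  grid functions, and commutes with \<open>\<Lambda>_h\<close>.  If \<open>X\<close> lies in the kernel, pair the homogeneous equation
  with \<open>Z = A_h\<^sup>-\<^sup>1 X\<close>: both \<open>\<langle>\<Lambda>_h X, Z\<rangle> = \<langle>\<Lambda>_h A_h Z, Z\<rangle>\<close> and \<open>\<langle>A_h (G X), Z\<rangle> = \<langle>G X, X\<rangle>\<close> are real,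
  so the imaginary part of the equation reads \<open>\<parallel>X\<parallel>\<^sup>2 / s = 0\<close>.\<close>

subsection \<open>Linear algebra\<close>

text \<open>A dimension count inside \<open>V\<close>, since the space of all grids is
  infinite-dimensional. An injective \<open>f\<close> sends a finite basis \<open>B\<close> of
  \<open>V\<close> to an independent set of equal size, and a vector missed by \<open>f\<close>
  would enlarge that set beyond what \<open>span B\<close> can hold.\<close>

lemma (in vector_space) image_eq_if_kernel_trivial:
  assumes f: "Vector_Spaces.linear scale scale f"
    and V: "subspace V" and T: "finite T" "V \<subseteq> span T"
    and maps: "f ` V \<subseteq> V"
    and ker: "\<And>x. x \<in> V \<Longrightarrow> f x = 0 \<Longrightarrow> x = 0"
  shows "f ` V = V"
proof -
  interpret f: Vector_Spaces.linear scale scale f by (rule f)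
  obtain B where B: "B \<subseteq> V" "independent B" "V \<subseteq> span B"
    using maximal_independent_subset by blast
  have span_B: "span B = V"
    using B V by (simp add: span_minimal subset_antisym)
  have fin: "finite B"
    using independent_span_bound[OF T(1) B(2)] B(1) T(2) by blast
  have inj: "inj_on f (span B)"
    unfolding f.inj_on_iff_eq_0[OF subspace_span] using ker span_B by auto
  have ind: "independent (f ` B)"
    by (rule f.independent_inj_on_image[OF B(2) inj])
  have card: "card (f ` B) = card B"
    by (metis card_image inj inj_on_subset span_superset)
  have span_fB: "span (f ` B) = f ` V"
    by (simp add: f.span_image span_B)
  have "y \<in> f ` V" if y: "y \<in> V" for y
  proof (rule ccontr)
    assume not_in: "y \<notin> f ` V"
    then have "independent (insert y (f ` B))"
      using ind span_fB by (simp add: independent_insert)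
    moreover have "insert y (f ` B) \<subseteq> span B"
      using y maps B(1) span_B by auto
    ultimately have "card (insert y (f ` B)) \<le> card B"
      using independent_span_bound[OF fin] by blast
    moreover have "y \<notin> f ` B"
      using not_in B(1) by auto
    ultimately show False
      using fin card by simp
  qed
  then show ?thesis using maps by blast
qed

section \<open>Periodic grid functions as a finite-dimensional complex vector space\<close>

definition grid_scale :: "complex \<Rightarrow> complex grid \<Rightarrow> complex grid" where
  "grid_scale c w = (\<lambda>i j. c * w i j)"

interpretation grid: vector_space grid_scale
  by standard (auto simp: grid_scale_def fun_eq_iff algebra_simps)

text \<open>Passes from the pointwise form, in which the difference operators are computed, to the
  abstract addition and scaling.\<close>

lemma linear_gridI:
  assumes "\<And>f g. L (\<lambda>i j. f i j + g i j) = (\<lambda>i j. L f i j + L g i j)"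
    and "\<And>c f. L (\<lambda>i j. c * f i j) = (\<lambda>i j. c * L f i j)"
  shows "Vector_Spaces.linear grid_scale grid_scale L"
proof
  show "L (f + g) = L f + L g" for f g
    using assms(1)[of f g] by (simp add: plus_fun_def)
  show "L (grid_scale c f) = grid_scale c (L f)" for c f
    using assms(2)[of c f] by (simp add: grid_scale_def)
qed

lemma per_grid_iff:
  "w \<in> per_grid Mx My \<longleftrightarrow> (\<forall>i j. w (i + int Mx) j = w i j) \<and> (\<forall>i j. w i (j + int My) = w i j)"
  by (auto simp: per_grid_def)

lemma per_gridD:
  assumes "w \<in> per_grid Mx My"
  shows "w (i + int Mx) j = w i j" "w i (j + int My) = w i j"
  using assms by (auto simp: per_grid_def)

lemma periodic_mod:
  fixes f :: "int \<Rightarrow> 'a"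
  assumes "\<And>i. f (i + int M) = f i"
  shows "f (i mod int M) = f i"
proof -
  have nat: "f (i + int M * int n) = f i" for i n
  proof (induction n)
    case (Suc n)
    then show ?case
      using assms[of "i + int M * int n"] by (simp add: algebra_simps)
  qed simp
  have "f (i + int M * k) = f i" for i k
  proof (cases "k \<ge> 0")
    case True
    then show ?thesis using nat[of i "nat k"] by simp
  next
    case False
    \<comment> \<open>For negative \<open>k\<close>, start at \<open>i + int M * k\<close> and walk
      forward \<open>- k\<close> periods back to \<open>i\<close>.\<close>
    then show ?thesis using nat[of "i + int M * k" "nat (- k)"] by simp
  qed
  from this[of "i mod int M" "i div int M"] show ?thesis by simp
qed

lemma per_grid_mod:
  assumes "w \<in> per_grid Mx My"
  shows "w (i mod int Mx) (j mod int My) = w i j"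
proof -
  have "w (i mod int Mx) (j mod int My) = w i (j mod int My)"
    by (rule periodic_mod) (rule per_gridD[OF assms])
  also have "\<dots> = w i j"
    by (rule periodic_mod) (rule per_gridD[OF assms])
  finally show ?thesis .
qed

lemma subspace_per_grid: "grid.subspace (per_grid Mx My)"
  by (auto simp: grid.subspace_def per_grid_iff grid_scale_def)

text \<open>Kronecker deltas repeated periodically, one for each point \<open>p\<close> of the cell.
  They are the finite spanning set.\<close>

definition grid_delta :: "nat \<Rightarrow> nat \<Rightarrow> nat \<times> nat \<Rightarrow> complex grid" where
  "grid_delta Mx My p =
     (\<lambda>i j. if i mod int Mx = int (fst p) \<and> j mod int My = int (snd p) then 1 else 0)"

lemma sum_grid_apply: "(\<Sum>p\<in>P. (F p :: complex grid)) i j = (\<Sum>p\<in>P. F p i j)"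
  by (induction P rule: infinite_finite_induct) auto

lemma per_grid_subset_span:
  assumes M: "Mx > 0" "My > 0"
  shows "per_grid Mx My \<subseteq> grid.span (grid_delta Mx My ` ({..<Mx} \<times> {..<My}))"
proof
  fix w :: "complex grid" assume w: "w \<in> per_grid Mx My"
  let ?P = "{..<Mx} \<times> {..<My}"
  let ?F = "\<lambda>p. grid_scale (w (int (fst p)) (int (snd p))) (grid_delta Mx My p)"
  have eq: "w i j = sum ?F ?P i j" for i j
  proof -
    let ?q = "(nat (i mod int Mx), nat (j mod int My))"
    have q: "?q \<in> ?P" using M by (auto simp: nat_less_iff)
    \<comment> \<open>Among the points of the cell, only the pair of residues of \<open>i\<close>
      and \<open>j\<close> contributes.\<close>
    have "sum ?F ?P i j = (\<Sum>p\<in>?P. if p = ?q then w (i mod int Mx) (j mod int My) else 0)"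
      unfolding sum_grid_apply
    proof (rule sum.cong)
      fix p assume "p \<in> ?P"
      have "i mod int Mx = int (fst p) \<and> j mod int My = int (snd p) \<longleftrightarrow> p = ?q"
        using M by (cases p) (auto simp: nat_eq_iff2)
      then show "?F p i j = (if p = ?q then w (i mod int Mx) (j mod int My) else 0)"
        by (auto simp: grid_scale_def grid_delta_def)
    qed simp
    also have "\<dots> = w i j"
      using q per_grid_mod[OF w] by simp
    finally show ?thesis by simp
  qed
  have "w = sum ?F ?P" by (intro ext eq)
  also have "\<dots> \<in> grid.span (grid_delta Mx My ` ?P)"
    by (intro grid.span_sum grid.span_scale grid.span_base imageI)
  finally show "w \<in> grid.span (grid_delta Mx My ` ?P)" .
qed

text \<open>Reduces solvability to a trivial kernel; applied to \<open>A_h\<close> and then to the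
  Crank-Nicolson operator.\<close>

lemma per_grid_surj:
  assumes M: "Mx > 0" "My > 0"
    and L: "Vector_Spaces.linear grid_scale grid_scale L"
    and maps: "\<And>w. w \<in> per_grid Mx My \<Longrightarrow> L w \<in> per_grid Mx My"
    and ker: "\<And>w. w \<in> per_grid Mx My \<Longrightarrow> L w = 0 \<Longrightarrow> w = 0"
    and g: "g \<in> per_grid Mx My"
  obtains w where "w \<in> per_grid Mx My" "L w = g"
proof -
  have "L ` per_grid Mx My = per_grid Mx My"
    by (rule grid.image_eq_if_kernel_trivial[OF L subspace_per_grid _ per_grid_subset_span[OF M]])
      (use maps ker in auto)
  with g that show ?thesis by (metis imageE)
qed

subsection \<open>Sums over a period\<close>

definition grid_sum :: "nat \<Rightarrow> nat \<Rightarrow> 'a::comm_monoid_add grid \<Rightarrow> 'a" where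
  "grid_sum Mx My w = (\<Sum>i<Mx. \<Sum>j<My. w (int i) (int j))"

text \<open>The shift trades the summand \<open>f 0\<close> for \<open>f (int M)\<close>, and these
  agree.\<close>

lemma sum_periodic_shift:
  fixes f :: "int \<Rightarrow> 'a::ab_group_add"
  assumes "f (int M) = f 0"
  shows "(\<Sum>i<M. f (int i + 1)) = (\<Sum>i<M. f (int i))"
proof -
  have "f 0 + (\<Sum>i<M. f (int i + 1)) = (\<Sum>i<M. f (int i)) + f (int M)"
    using sum.lessThan_Suc_shift[of "\<lambda>i. f (int i)" M] by (simp add: add.commute)
  with assms show ?thesis by (simp add: add.commute)
qed

lemma grid_sum_shift:
  fixes w :: "'a::ab_group_add grid"
  assumes "w \<in> per_grid Mx My"
  shows "grid_sum Mx My (\<lambda>i j. w (i + 1) j) = grid_sum Mx My w"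
    and "grid_sum Mx My (\<lambda>i j. w i (j + 1)) = grid_sum Mx My w"
proof -
  have x: "w (int Mx) j = w 0 j" and y: "w i (int My) = w i 0" for i j
    using per_gridD[OF assms, of 0] per_gridD[OF assms, of _ 0] by auto
  have "(\<Sum>j<My. \<Sum>i<Mx. w (int i + 1) (int j)) = (\<Sum>j<My. \<Sum>i<Mx. w (int i) (int j))"
    by (intro sum.cong refl sum_periodic_shift x)
  then show "grid_sum Mx My (\<lambda>i j. w (i + 1) j) = grid_sum Mx My w"
    \<comment> \<open>The shifted index is the outer one; exchanging the sums makes it the inner
      one.\<close>
    unfolding grid_sum_def by (subst (1 2) sum.swap)
  show "grid_sum Mx My (\<lambda>i j. w i (j + 1)) = grid_sum Mx My w"
    unfolding grid_sum_def by (intro sum.cong refl sum_periodic_shift y)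
qed

lemma grid_sum_shift_back:
  fixes w :: "'a::ab_group_add grid"
  assumes w: "w \<in> per_grid Mx My"
  shows "grid_sum Mx My (\<lambda>i j. w (i - 1) j) = grid_sum Mx My w"
    and "grid_sum Mx My (\<lambda>i j. w i (j - 1)) = grid_sum Mx My w"
proof -
  have "w (i + int Mx - 1) j = w (i - 1) j" "w i (j + int My - 1) = w i (j - 1)" for i j
    using per_gridD(1)[OF w, of "i - 1" j] per_gridD(2)[OF w, of i "j - 1"]
    by (simp_all add: algebra_simps)
  then have "(\<lambda>i j. w (i - 1) j) \<in> per_grid Mx My" "(\<lambda>i j. w i (j - 1)) \<in> per_grid Mx My"
    using per_gridD[OF w] by (auto simp: per_grid_iff)
  from grid_sum_shift(1)[OF this(1)] grid_sum_shift(2)[OF this(2)]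
  show "grid_sum Mx My (\<lambda>i j. w (i - 1) j) = grid_sum Mx My w"
    and "grid_sum Mx My (\<lambda>i j. w i (j - 1)) = grid_sum Mx My w" by simp_all
qed

lemma grid_sum_add:
  "grid_sum Mx My (\<lambda>i j. f i j + g i j) = grid_sum Mx My f + grid_sum Mx My g"
  by (simp add: grid_sum_def sum.distrib)

lemma grid_sum_mult:
  fixes f :: "'a::semiring_0 grid"
  shows "grid_sum Mx My (\<lambda>i j. c * f i j) = c * grid_sum Mx My f"
  by (simp add: grid_sum_def sum_distrib_left)

lemma grid_sum_mono:
  fixes f g :: "real grid"
  assumes "\<And>i j. f i j \<le> g i j"
  shows "grid_sum Mx My f \<le> grid_sum Mx My g"
  using assms by (simp add: grid_sum_def sum_mono)

text \<open>Nonnegative terms with sum at most 0 all vanish on the cell, and periodicity carries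
  this to every index.\<close>

lemma grid_eq_0_if_sum_le_0:
  fixes f :: "real grid"
  assumes f: "f \<in> per_grid Mx My" and M: "Mx > 0" "My > 0"
    and nonneg: "\<And>i j. 0 \<le> f i j" and le: "grid_sum Mx My f \<le> 0"
  shows "f i j = 0"
proof -
  let ?i = "nat (i mod int Mx)" and ?j = "nat (j mod int My)"
  have "grid_sum Mx My f = 0"
    using le nonneg by (simp add: grid_sum_def antisym sum_nonneg)
  then have "(\<Sum>j<My. f (int i) (int j)) = 0" if "i < Mx" for i
    using that nonneg by (simp add: grid_sum_def sum_nonneg_eq_0_iff sum_nonneg)
  then have "f (int i) (int j) = 0" if "i < Mx" "j < My" for i j
    using that nonneg by (simp add: sum_nonneg_eq_0_iff)
  from this[of ?i ?j] show ?thesis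
    using M per_grid_mod[OF f] by (simp add: nat_less_iff)
qed

subsection \<open>The difference operators\<close>

lemma per_grid_delta2:
  assumes w: "w \<in> per_grid Mx My"
  shows "delta2_x hx w \<in> per_grid Mx My" "delta2_y hy w \<in> per_grid Mx My"
proof -
  have "w (i + int Mx + 1) j = w (i + 1) j" "w (i + int Mx - 1) j = w (i - 1) j"
    "w i (j + int My + 1) = w i (j + 1)" "w i (j + int My - 1) = w i (j - 1)" for i j
    using per_gridD(1)[OF w, of "i + 1" j] per_gridD(1)[OF w, of "i - 1" j]
      per_gridD(2)[OF w, of i "j + 1"] per_gridD(2)[OF w, of i "j - 1"]
    by (simp_all add: algebra_simps)
  then show "delta2_x hx w \<in> per_grid Mx My" "delta2_y hy w \<in> per_grid Mx My"
    using per_gridD[OF w] by (auto simp: per_grid_iff delta2_x_def delta2_y_def)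
qed

lemma per_grid_A:
  assumes "w \<in> per_grid Mx My"
  shows "A_x hx w \<in> per_grid Mx My" "A_y hy w \<in> per_grid Mx My"
  using assms per_grid_delta2[OF assms, of hx] per_grid_delta2[OF assms, of hy]
  by (auto simp: per_grid_iff A_x_def A_y_def)

lemma per_grid_A_h: "w \<in> per_grid Mx My \<Longrightarrow> A_h hx hy w \<in> per_grid Mx My"
  by (simp add: A_h_def per_grid_A)

lemma per_grid_Lambda_h:
  assumes "w \<in> per_grid Mx My"
  shows "Lambda_h hx hy w \<in> per_grid Mx My"
  using per_grid_A(2)[OF per_grid_delta2(1)[OF assms]] per_grid_A(1)[OF per_grid_delta2(2)[OF assms]]
  by (auto simp: per_grid_iff Lambda_h_def)

text \<open>Written as a scalar times a sum, with \<open>+ (-2) *\<close> for the subtraction, so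
  that the rules for sums and scalar multiples of grids apply by rewriting.\<close>

lemma delta2_expand:
  "delta2_x hx w = (\<lambda>i j. complex_of_real (1 / hx\<^sup>2) * (w (i + 1) j + (-2) * w i j + w (i - 1) j))"
  "delta2_y hy w = (\<lambda>i j. complex_of_real (1 / hy\<^sup>2) * (w i (j + 1) + (-2) * w i j + w i (j - 1)))"
  by (auto simp: delta2_x_def delta2_y_def)

lemma delta2_add:
  "delta2_x hx (\<lambda>i j. f i j + g i j) = (\<lambda>i j. delta2_x hx f i j + delta2_x hx g i j)"
  "delta2_y hy (\<lambda>i j. f i j + g i j) = (\<lambda>i j. delta2_y hy f i j + delta2_y hy g i j)"
  unfolding delta2_expand by (intro ext, algebra)+

lemma delta2_mult:
  "delta2_x hx (\<lambda>i j. c * f i j) = (\<lambda>i j. c * delta2_x hx f i j)"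
  "delta2_y hy (\<lambda>i j. c * f i j) = (\<lambda>i j. c * delta2_y hy f i j)"
  unfolding delta2_expand by (intro ext, algebra)+

lemma A_add:
  "A_x hx (\<lambda>i j. f i j + g i j) = (\<lambda>i j. A_x hx f i j + A_x hx g i j)"
  "A_y hy (\<lambda>i j. f i j + g i j) = (\<lambda>i j. A_y hy f i j + A_y hy g i j)"
  by (auto simp: A_x_def A_y_def delta2_add fun_eq_iff algebra_simps)

lemma A_mult:
  "A_x hx (\<lambda>i j. c * f i j) = (\<lambda>i j. c * A_x hx f i j)"
  "A_y hy (\<lambda>i j. c * f i j) = (\<lambda>i j. c * A_y hy f i j)"
  by (auto simp: A_x_def A_y_def delta2_mult fun_eq_iff algebra_simps)

lemma A_h_add: "A_h hx hy (\<lambda>i j. f i j + g i j) = (\<lambda>i j. A_h hx hy f i j + A_h hx hy g i j)"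
  by (simp add: A_h_def A_add)

lemma A_h_mult: "A_h hx hy (\<lambda>i j. c * f i j) = (\<lambda>i j. c * A_h hx hy f i j)"
  by (simp add: A_h_def A_mult)

lemma Lambda_h_add:
  "Lambda_h hx hy (\<lambda>i j. f i j + g i j) = (\<lambda>i j. Lambda_h hx hy f i j + Lambda_h hx hy g i j)"
  by (simp add: Lambda_h_def A_add delta2_add algebra_simps)

lemma Lambda_h_mult: "Lambda_h hx hy (\<lambda>i j. c * f i j) = (\<lambda>i j. c * Lambda_h hx hy f i j)"
  by (simp add: Lambda_h_def A_mult delta2_mult algebra_simps)

text \<open>Shifts in the two directions commute. All operators are polynomials in these shifts, so
  the commutation rules below follow from this one and linearity.\<close>

lemma delta2_commute: "delta2_y hy (delta2_x hx w) = delta2_x hx (delta2_y hy w)"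
  unfolding delta2_expand by (intro ext) algebra

lemma A_delta2_commute:
  "A_x hx (delta2_x hx w) = delta2_x hx (A_x hx w)" "A_y hy (delta2_x hx w) = delta2_x hx (A_y hy w)"
  "A_x hx (delta2_y hy w) = delta2_y hy (A_x hx w)" "A_y hy (delta2_y hy w) = delta2_y hy (A_y hy w)"
  unfolding A_x_def A_y_def by (simp_all only: delta2_add delta2_mult delta2_commute)

lemma A_commute: "A_y hy (A_x hx w) = A_x hx (A_y hy w)"
  unfolding A_x_def by (simp only: A_add A_mult A_delta2_commute)

lemma Lambda_A_commute: "Lambda_h hx hy (A_h hx hy w) = A_h hx hy (Lambda_h hx hy w)"
  unfolding Lambda_h_def A_h_def by (simp only: A_add A_mult A_delta2_commute A_commute)

section \<open>The unweighted inner product over one period and self-adjointness\<close>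

definition grid_inner :: "nat \<Rightarrow> nat \<Rightarrow> complex grid \<Rightarrow> complex grid \<Rightarrow> complex" where
  "grid_inner Mx My f g = grid_sum Mx My (\<lambda>i j. f i j * cnj (g i j))"

lemma grid_inner_cnj: "cnj (grid_inner Mx My f g) = grid_inner Mx My g f"
  by (simp add: grid_inner_def grid_sum_def mult.commute)

lemma grid_inner_add:
  "grid_inner Mx My (\<lambda>i j. f i j + g i j) w = grid_inner Mx My f w + grid_inner Mx My g w"
  "grid_inner Mx My w (\<lambda>i j. f i j + g i j) = grid_inner Mx My w f + grid_inner Mx My w g"
  by (simp_all add: grid_inner_def distrib_left distrib_right grid_sum_add)

lemma grid_inner_mult:
  "grid_inner Mx My (\<lambda>i j. c * f i j) w = c * grid_inner Mx My f w"
  "grid_inner Mx My w (\<lambda>i j. c * f i j) = cnj c * grid_inner Mx My w f"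
  by (simp_all add: grid_inner_def mult.assoc mult.left_commute grid_sum_mult)

lemma grid_inner_self: "grid_inner Mx My f f = of_real (grid_sum Mx My (abs_sq f))"
  by (simp add: grid_inner_def grid_sum_def abs_sq_def complex_norm_square del: of_real_power)

text \<open>The adjoint of a forward shift is the backward shift: the summand on the left is
  periodic, so moving it back by one index keeps its sum.\<close>

lemma grid_inner_shift:
  assumes f: "f \<in> per_grid Mx My" and g: "g \<in> per_grid Mx My"
  shows "grid_inner Mx My (\<lambda>i j. f (i + 1) j) g = grid_inner Mx My f (\<lambda>i j. g (i - 1) j)"
    and "grid_inner Mx My (\<lambda>i j. f i (j + 1)) g = grid_inner Mx My f (\<lambda>i j. g i (j - 1))"
proof -
  have per: "(\<lambda>i j. f (i + 1) j * cnj (g i j)) \<in> per_grid Mx My"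
    "(\<lambda>i j. f i (j + 1) * cnj (g i j)) \<in> per_grid Mx My"
    using per_gridD[OF f] per_gridD[OF g]
    by (auto simp: per_grid_iff) (metis (no_types) add.assoc add.commute)+
  show "grid_inner Mx My (\<lambda>i j. f (i + 1) j) g = grid_inner Mx My f (\<lambda>i j. g (i - 1) j)"
    and "grid_inner Mx My (\<lambda>i j. f i (j + 1)) g = grid_inner Mx My f (\<lambda>i j. g i (j - 1))"
    using grid_sum_shift_back(1)[OF per(1)] grid_sum_shift_back(2)[OF per(2)]
    by (simp_all add: grid_inner_def)
qed

lemma grid_inner_shift_back:
  assumes f: "f \<in> per_grid Mx My" and g: "g \<in> per_grid Mx My"
  shows "grid_inner Mx My (\<lambda>i j. f (i - 1) j) g = grid_inner Mx My f (\<lambda>i j. g (i + 1) j)"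
    and "grid_inner Mx My (\<lambda>i j. f i (j - 1)) g = grid_inner Mx My f (\<lambda>i j. g i (j + 1))"
  using grid_inner_shift[OF g f] by (metis grid_inner_cnj)+

text \<open>Taking adjoints swaps the two neighbours in the stencil, which is symmetric with real
  coefficients.\<close>

lemma delta2_self_adjoint:
  assumes "f \<in> per_grid Mx My" "g \<in> per_grid Mx My"
  shows "grid_inner Mx My (delta2_x hx f) g = grid_inner Mx My f (delta2_x hx g)"
    and "grid_inner Mx My (delta2_y hy f) g = grid_inner Mx My f (delta2_y hy g)"
  unfolding delta2_expand grid_inner_mult grid_inner_add
    grid_inner_shift[OF assms] grid_inner_shift_back[OF assms]
  by (simp_all add: algebra_simps)

lemma A_self_adjoint:
  assumes "f \<in> per_grid Mx My" "g \<in> per_grid Mx My"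
  shows "grid_inner Mx My (A_x hx f) g = grid_inner Mx My f (A_x hx g)"
    and "grid_inner Mx My (A_y hy f) g = grid_inner Mx My f (A_y hy g)"
  unfolding A_x_def A_y_def grid_inner_mult grid_inner_add delta2_self_adjoint[OF assms] by simp_all

text \<open>A product of self-adjoint operators is self-adjoint when they commute;
  \<open>A_commute\<close> provides this. The summands of \<open>Lambda_h\<close> are treated in the
  same way.\<close>

lemma A_h_self_adjoint:
  assumes "f \<in> per_grid Mx My" "g \<in> per_grid Mx My"
  shows "grid_inner Mx My (A_h hx hy f) g = grid_inner Mx My f (A_h hx hy g)"
  unfolding A_h_def using assms
  by (metis A_commute A_self_adjoint per_grid_A)

lemma Lambda_h_self_adjoint:
  assumes "f \<in> per_grid Mx My" "g \<in> per_grid Mx My"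
  shows "grid_inner Mx My (Lambda_h hx hy f) g = grid_inner Mx My f (Lambda_h hx hy g)"
  unfolding Lambda_h_def grid_inner_add using assms
  by (simp add: A_self_adjoint delta2_self_adjoint per_grid_A per_grid_delta2 A_delta2_commute)

text \<open>\<open>12 A_x w = 10 w + w(\<cdot> + 1) + w(\<cdot> - 1)\<close>, so \<open>A_x w = 0\<close> gives \<open>10 \<parallel>w\<parallel>\<^sub>1 \<le> 2 \<parallel>w\<parallel>\<^sub>1\<close>.\<close>

lemma A_x_kernel:
  assumes w: "w \<in> per_grid Mx My" and M: "Mx > 0" "My > 0" and h: "hx \<noteq> 0"
    and A: "A_x hx w = 0"
  shows "w = 0"
proof -
  let ?n = "\<lambda>i j. cmod (w i j)"
  have n: "?n \<in> per_grid Mx My" using w by (auto simp: per_grid_iff)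
  have le: "10 * ?n i j \<le> ?n (i + 1) j + ?n (i - 1) j" for i j
  proof -
    have "A_x hx w i j = 0" using A by simp
    moreover have "A_x hx w i j = w i j + (w (i + 1) j - 2 * w i j + w (i - 1) j) / 12"
      using h by (simp add: A_x_def delta2_x_def)
    ultimately have "10 * w i j = - (w (i + 1) j + w (i - 1) j)"
      by (simp add: field_simps) algebra
    then have "cmod (10 * w i j) \<le> ?n (i + 1) j + ?n (i - 1) j"
      by (metis norm_minus_cancel norm_triangle_ineq)
    then show ?thesis by (simp add: norm_mult)
  qed
  have "10 * grid_sum Mx My ?n \<le> 2 * grid_sum Mx My ?n"
    using grid_sum_mono[of "\<lambda>i j. 10 * ?n i j" "\<lambda>i j. ?n (i + 1) j + ?n (i - 1) j" Mx My, OF le]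
    by (simp add: grid_sum_add grid_sum_mult grid_sum_shift(1)[OF n] grid_sum_shift_back(1)[OF n])
  then have "grid_sum Mx My ?n \<le> 0" by simp
  from grid_eq_0_if_sum_le_0[OF n M _ this] show ?thesis by (simp add: fun_eq_iff)
qed

text \<open>Transposing the grid exchanges the two directions, and with them \<open>Mx\<close> and
  \<open>My\<close>.\<close>

lemma A_y_kernel:
  assumes w: "w \<in> per_grid Mx My" and M: "Mx > 0" "My > 0" and h: "hy \<noteq> 0"
    and A: "A_y hy w = 0"
  shows "w = 0"
proof -
  have "A_x hy (\<lambda>i j. w j i) = 0"
    using A by (simp add: A_x_def A_y_def delta2_x_def delta2_y_def fun_eq_iff)
  moreover have "(\<lambda>i j. w j i) \<in> per_grid My Mx"
    using w by (auto simp: per_grid_iff)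
  ultimately have "(\<lambda>i j. w j i) = 0"
    using A_x_kernel M h by blast
  then show ?thesis by (simp add: fun_eq_iff)
qed

text \<open>The kernel of the composition is peeled off: first \<open>A_x\<close> forces
  \<open>A_y hy w = 0\<close>, then \<open>A_y\<close> forces \<open>w = 0\<close>.\<close>

lemma A_h_surj:
  assumes M: "Mx > 0" "My > 0" and h: "hx \<noteq> 0" "hy \<noteq> 0" and g: "g \<in> per_grid Mx My"
  obtains w where "w \<in> per_grid Mx My" "A_h hx hy w = g"
proof (rule per_grid_surj[OF M _ _ _ g, of "A_h hx hy"])
  show "Vector_Spaces.linear grid_scale grid_scale (A_h hx hy)"
    by (rule linear_gridI) (rule A_h_add A_h_mult)+
  show "w = 0" if "w \<in> per_grid Mx My" "A_h hx hy w = 0" for w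
    using that A_x_kernel[OF per_grid_A(2) M h(1)] A_y_kernel[OF _ M h(2)]
    unfolding A_h_def by blast
qed (use that in \<open>auto simp: per_grid_A_h\<close>)

subsection \<open>Crank--Nicolson steps\<close>

text \<open>The part of the equation linear in \<open>X = W' + W\<close>. The halves come from the
  average \<open>X / 2\<close>; the nested brackets make it a plain sum of three scaled
  grids.\<close>

definition cn_op ::
    "real \<Rightarrow> real \<Rightarrow> real \<Rightarrow> real \<Rightarrow> real grid \<Rightarrow> complex grid \<Rightarrow> complex grid" where
  "cn_op hx hy \<kappa> s G X = (\<lambda>i j. (\<i> / of_real s) * A_h hx hy X i j
     + (of_real (\<kappa> / 2) * Lambda_h hx hy X i j
     + (1 / 2) * A_h hx hy (\<lambda>k l. of_real (G k l) * X k l) i j))"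

lemma linear_cn_op: "Vector_Spaces.linear grid_scale grid_scale (cn_op hx hy \<kappa> s G)"
proof (rule linear_gridI)
  show "cn_op hx hy \<kappa> s G (\<lambda>i j. f i j + g i j)
      = (\<lambda>i j. cn_op hx hy \<kappa> s G f i j + cn_op hx hy \<kappa> s G g i j)" for f g
    unfolding cn_op_def by (simp only: A_h_add Lambda_h_add distrib_left add_ac)
  show "cn_op hx hy \<kappa> s G (\<lambda>i j. c * f i j) = (\<lambda>i j. c * cn_op hx hy \<kappa> s G f i j)" for c f
    unfolding cn_op_def
    by (simp only: A_h_mult Lambda_h_mult distrib_left mult.left_commute[of _ c])
qed

lemma per_grid_cn_op:
  assumes "X \<in> per_grid Mx My" "G \<in> per_grid Mx My"
  shows "cn_op hx hy \<kappa> s G X \<in> per_grid Mx My"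
proof -
  have "(\<lambda>k l. of_real (G k l) * X k l) \<in> per_grid Mx My"
    using assms by (auto simp: per_grid_iff)
  from per_grid_A_h[OF this, of hx hy] per_grid_A_h[OF assms(1), of hx hy]
    per_grid_Lambda_h[OF assms(1), of hx hy]
  show ?thesis by (auto simp: per_grid_iff cn_op_def)
qed

text \<open>Pairing with \<open>X\<close> itself would leave the inner product of
  \<open>A_h (G X)\<close> with \<open>X\<close>, which need not be real because \<open>A_h\<close>
  and multiplication by \<open>G\<close> do not commute. Pairing with the preimage \<open>Z\<close>
  moves \<open>A_h\<close> away from \<open>G X\<close>.\<close>

lemma cn_op_kernel:
  assumes M: "Mx > 0" "My > 0" and h: "hx \<noteq> 0" "hy \<noteq> 0" and s: "s \<noteq> 0"
    and X: "X \<in> per_grid Mx My" and G: "G \<in> per_grid Mx My"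
    and eq: "cn_op hx hy \<kappa> s G X = 0"
  shows "X = 0"
proof -
  let ?ip = "grid_inner Mx My" and ?GX = "\<lambda>k l. of_real (G k l) * X k l"
  obtain Z where Z: "Z \<in> per_grid Mx My" "A_h hx hy Z = X"
    by (rule A_h_surj[OF M h X])
  have GX: "?GX \<in> per_grid Mx My"
    using X G by (auto simp: per_grid_iff)
  have A: "?ip (A_h hx hy X) Z = ?ip X X" "?ip (A_h hx hy ?GX) Z = ?ip ?GX X"
    using A_h_self_adjoint[OF X Z(1)] A_h_self_adjoint[OF GX Z(1)] Z(2) by simp_all
  \<comment> \<open>Move \<open>Lambda_h\<close> to \<open>Z\<close>, write \<open>X\<close> as
    \<open>A_h Z\<close>, move that \<open>A_h\<close> across, and commute it past
    \<open>Lambda_h\<close> to recover \<open>X\<close>.\<close>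
  have "?ip (Lambda_h hx hy X) Z = ?ip Z (Lambda_h hx hy X)"
    by (metis A_h_self_adjoint Lambda_A_commute Lambda_h_self_adjoint X Z per_grid_Lambda_h)
  then have im_Lambda: "Im (?ip (Lambda_h hx hy X) Z) = 0"
    by (metis cnj.simps(2) equal_neg_zero grid_inner_cnj)
  \<comment> \<open>Here \<open>G\<close> is real-valued, hence unaffected by conjugation.\<close>
  have "?ip ?GX X = ?ip X ?GX"
    by (simp add: grid_inner_def mult_ac)
  then have im_G: "Im (?ip ?GX X) = 0"
    by (metis cnj.simps(2) equal_neg_zero grid_inner_cnj)
  have "0 = ?ip (cn_op hx hy \<kappa> s G X) Z"
    by (simp add: eq grid_inner_def grid_sum_def)
  also have "\<dots> = (\<i> / of_real s) * ?ip X X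
      + (of_real (\<kappa> / 2) * ?ip (Lambda_h hx hy X) Z + (1 / 2) * ?ip ?GX X)"
    unfolding cn_op_def grid_inner_add grid_inner_mult A ..
  finally have "0 = Im \<dots>" by simp
  \<comment> \<open>The terms with \<open>\<kappa>\<close> and \<open>G\<close> are real, so only
    the first survives in the imaginary part.\<close>
  then have "grid_sum Mx My (abs_sq X) / s = 0"
    using im_Lambda im_G by (simp add: grid_inner_self Im_divide_of_real)
  then have zero: "grid_sum Mx My (abs_sq X) \<le> 0" using s by simp
  have "abs_sq X \<in> per_grid Mx My"
    using X by (auto simp: per_grid_iff abs_sq_def)
  from grid_eq_0_if_sum_le_0[OF this M _ zero] show ?thesis
    by (simp add: fun_eq_iff abs_sq_def)
qed

text \<open>Since \<open>W' - W = (W' + W) - 2 W\<close>, the time difference splits into a term in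
  the new unknown and a known term, which goes to the right-hand side.\<close>

lemma cn_eq_iff:
  "cn_eq hx hy \<kappa> s G W W' \<longleftrightarrow>
     cn_op hx hy \<kappa> s G (W' + W) = (\<lambda>i j. (2 * \<i> / of_real s) * A_h hx hy W i j)"
proof -
  have 1: "(\<lambda>k l. (W' k l - W k l) / of_real s)
      = (\<lambda>k l. (1 / of_real s) * ((W' + W) k l + (-2) * W k l))"
    by (simp add: fun_eq_iff)
  have 2: "(\<lambda>k l. (W' k l + W k l) / 2) = (\<lambda>k l. (1 / 2) * (W' + W) k l)"
    by (simp add: fun_eq_iff)
  have 3: "(\<lambda>k l. of_real (G k l) * ((W' k l + W k l) / 2))
      = (\<lambda>k l. (1 / 2) * (of_real (G k l) * (W' + W) k l))"
    by (simp add: fun_eq_iff)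
  show ?thesis
    unfolding cn_eq_def cn_op_def fun_eq_iff 1 2 3 A_h_mult A_h_add Lambda_h_mult
    by (intro all_cong1) (auto simp: algebra_simps)
qed

lemma cn_eq_ex1:
  assumes M: "Mx > 0" "My > 0" and h: "hx \<noteq> 0" "hy \<noteq> 0" and s: "s \<noteq> 0"
    and W: "W \<in> per_grid Mx My" and G: "G \<in> per_grid Mx My"
  shows "\<exists>!W'. W' \<in> per_grid Mx My \<and> cn_eq hx hy \<kappa> s G W W'"
proof -
  let ?L = "cn_op hx hy \<kappa> s G" and ?r = "\<lambda>i j. (2 * \<i> / of_real s) * A_h hx hy W i j"
  interpret L: Vector_Spaces.linear grid_scale grid_scale ?L by (rule linear_cn_op)
  have r: "?r \<in> per_grid Mx My"
    using per_grid_A_h[OF W, of hx hy] by (auto simp: per_grid_iff)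
  obtain X where X: "X \<in> per_grid Mx My" "?L X = ?r"
    by (rule per_grid_surj[OF M linear_cn_op per_grid_cn_op[OF _ G] cn_op_kernel[OF M h s _ G] r])
  note diff = grid.subspace_diff[OF subspace_per_grid]
  show ?thesis
  \<comment> \<open>Undoes the substitution \<open>X = W' + W\<close>.\<close>
  proof (rule ex1I[of _ "X - W"])
    show "X - W \<in> per_grid Mx My \<and> cn_eq hx hy \<kappa> s G W (X - W)"
      using X diff[OF X(1) W] by (simp add: cn_eq_iff)
    fix W' assume W': "W' \<in> per_grid Mx My \<and> cn_eq hx hy \<kappa> s G W W'"
    then have "?L (W' + W - X) = 0"
      using X(2) by (simp only: L.diff cn_eq_iff) simp
    moreover have "W' + W - X \<in> per_grid Mx My"
      using W' W X(1) by (simp add: diff grid.subspace_add[OF subspace_per_grid])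
    ultimately have "W' + W - X = 0"
      using cn_op_kernel[OF M h s _ G] by blast
    then show "W' = X - W" by (simp add: algebra_simps)
  qed
qed

text \<open>With \<open>\<Phi>\<close> and \<open>\<Psi>\<close> already known, the two equations
  decouple. The equivalence form lets each step below replace its equations by equality with an
  explicit tuple.\<close>

lemma cn_pair_ex1:
  assumes "Mx > 0" "My > 0" "hx \<noteq> 0" "hy \<noteq> 0" "s \<noteq> 0"
    and "U \<in> per_grid Mx My" "V \<in> per_grid Mx My" "\<Phi> \<in> per_grid Mx My" "\<Psi> \<in> per_grid Mx My"
  shows "\<exists>U' V'. \<forall>U'' V''. U'' \<in> per_grid Mx My \<and> V'' \<in> per_grid Mx My \<and>
    cn_pair hx hy \<kappa> \<beta> s \<Phi> \<Psi> U V U'' V'' \<longleftrightarrow> U'' = U' \<and> V'' = V'"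
proof -
  have "(\<lambda>i j. \<Phi> i j + \<beta> * \<Psi> i j) \<in> per_grid Mx My" "(\<lambda>i j. \<Psi> i j + \<beta> * \<Phi> i j) \<in> per_grid Mx My"
    using assms(8,9) by (auto simp: per_grid_iff)
  from cn_eq_ex1[OF assms(1-5) assms(6) this(1), of \<kappa>] cn_eq_ex1[OF assms(1-5) assms(7) this(2), of \<kappa>]
  obtain U' V' where
    "U'' \<in> per_grid Mx My \<and> cn_eq hx hy \<kappa> s (\<lambda>i j. \<Phi> i j + \<beta> * \<Psi> i j) U U'' \<longleftrightarrow> U'' = U'"
    "V'' \<in> per_grid Mx My \<and> cn_eq hx hy \<kappa> s (\<lambda>i j. \<Psi> i j + \<beta> * \<Phi> i j) V V'' \<longleftrightarrow> V'' = V'"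
    for U'' V'' unfolding Ex1_def by blast
  then show ?thesis unfolding cn_pair_def by blast
qed

section \<open>Unique solvability of the individual steps\<close>

lemma per_grid_abs_sq: "w \<in> per_grid Mx My \<Longrightarrow> abs_sq w \<in> per_grid Mx My"
  by (auto simp: per_grid_iff abs_sq_def)

text \<open>Advancing the index by \<open>Mx\<close> or \<open>My\<close> moves the grid point by
  exactly one period of \<open>u\<close>.\<close>

lemma per_grid_grid_values:
  assumes "Mx > 0" "My > 0"
    and "\<And>x y. u (x + (xr - xl)) y = u x y" "\<And>x y. u x (y + (yr - yl)) = u x y"
  shows "grid_values xl yl ((xr - xl) / real Mx) ((yr - yl) / real My) u \<in> per_grid Mx My"
proof -
  have "xl + real_of_int (i + int Mx) * ((xr - xl) / real Mx)
      = (xl + real_of_int i * ((xr - xl) / real Mx)) + (xr - xl)"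
    "yl + real_of_int (j + int My) * ((yr - yl) / real My)
      = (yl + real_of_int j * ((yr - yl) / real My)) + (yr - yl)" for i j
    using assms(1,2) by (simp_all add: field_simps)
  then show ?thesis
    unfolding per_grid_iff grid_values_def by (simp only: assms(3,4)) simp
qed

lemma lrcd_step1_ex1:
  assumes "Mx > 0" "My > 0" "hx \<noteq> 0" "hy \<noteq> 0" "\<tau> \<noteq> 0"
    and U: "U0 \<in> per_grid Mx My" and V: "V0 \<in> per_grid Mx My"
  shows "\<exists>!(Uh, Vh, \<Phi>h, \<Psi>h). lrcd_step1 Mx My hx hy \<tau> \<kappa> \<beta> U0 V0 Uh Vh \<Phi>h \<Psi>h"
proof -
  have "\<tau> / 2 \<noteq> 0" using assms(5) by simp
  from cn_pair_ex1[OF assms(1-4) this U V per_grid_abs_sq[OF U] per_grid_abs_sq[OF V]]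
  obtain Uh Vh where *: "U'' \<in> per_grid Mx My \<and> V'' \<in> per_grid Mx My \<and>
      cn_pair hx hy \<kappa> \<beta> (\<tau> / 2) (abs_sq U0) (abs_sq V0) U0 V0 U'' V'' \<longleftrightarrow> U'' = Uh \<and> V'' = Vh"
    for U'' V'' by blast
  have "lrcd_step1 Mx My hx hy \<tau> \<kappa> \<beta> U0 V0 U'' V'' \<Phi> \<Psi> \<longleftrightarrow>
      (U'', V'', \<Phi>, \<Psi>) = (Uh, Vh, abs_sq Uh, abs_sq Vh)" for U'' V'' \<Phi> \<Psi>
    unfolding lrcd_step1_def using *[of U'' V''] per_grid_abs_sq by blast
  then show ?thesis by (intro ex1I[of _ "(Uh, Vh, abs_sq Uh, abs_sq Vh)"]) auto
qed

lemma lrcd_step2_ex1: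
  assumes "Mx > 0" "My > 0" "hx \<noteq> 0" "hy \<noteq> 0" "\<tau> \<noteq> 0"
    and "U0 \<in> per_grid Mx My" "V0 \<in> per_grid Mx My" "\<Phi>h \<in> per_grid Mx My" "\<Psi>h \<in> per_grid Mx My"
  shows "\<exists>!(U1, V1). lrcd_step2 Mx My hx hy \<tau> \<kappa> \<beta> U0 V0 \<Phi>h \<Psi>h U1 V1"
proof -
  from cn_pair_ex1[OF assms, of \<kappa> \<beta>] obtain U1 V1 where
    "lrcd_step2 Mx My hx hy \<tau> \<kappa> \<beta> U0 V0 \<Phi>h \<Psi>h U'' V'' \<longleftrightarrow> U'' = U1 \<and> V'' = V1" for U'' V''
    unfolding lrcd_step2_def by blast
  then show ?thesis by (intro ex1I[of _ "(U1, V1)"]) auto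
qed

text \<open>The new potentials are explicit in the previous data, so the remaining system is
  linear.\<close>

lemma lrcd_step3_ex1:
  assumes "Mx > 0" "My > 0" "hx \<noteq> 0" "hy \<noteq> 0" "\<tau> \<noteq> 0"
    and "U \<in> per_grid Mx My" "V \<in> per_grid Mx My" "\<Phi> \<in> per_grid Mx My" "\<Psi> \<in> per_grid Mx My"
  shows "\<exists>!(U', V', \<Phi>', \<Psi>'). lrcd_step3 Mx My hx hy \<tau> \<kappa> \<beta> U V \<Phi> \<Psi> U' V' \<Phi>' \<Psi>'"
proof -
  let ?\<Phi> = "\<lambda>i j. 2 * abs_sq U i j - \<Phi> i j" and ?\<Psi> = "\<lambda>i j. 2 * abs_sq V i j - \<Psi> i j"
  have per: "?\<Phi> \<in> per_grid Mx My" "?\<Psi> \<in> per_grid Mx My"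
    using assms(6-9) by (auto simp: per_grid_iff abs_sq_def)
  from cn_pair_ex1[OF assms(1-7) this] obtain U' V' where
    *: "U'' \<in> per_grid Mx My \<and> V'' \<in> per_grid Mx My \<and> cn_pair hx hy \<kappa> \<beta> \<tau> ?\<Phi> ?\<Psi> U V U'' V''
      \<longleftrightarrow> U'' = U' \<and> V'' = V'" for U'' V'' by blast
  have "lrcd_step3 Mx My hx hy \<tau> \<kappa> \<beta> U V \<Phi> \<Psi> U'' V'' \<Phi>' \<Psi>' \<longleftrightarrow>
      (U'', V'', \<Phi>', \<Psi>') = (U', V', ?\<Phi>, ?\<Psi>)" for U'' V'' \<Phi>' \<Psi>'
    unfolding lrcd_step3_def using *[of U'' V''] per by blast
  then show ?thesis by (intro ex1I[of _ "(U', V', ?\<Phi>, ?\<Psi>)"]) auto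
qed

section \<open>Runs of the scheme over several time levels\<close>

lemma lrcd_upto_per_grid:
  assumes run: "lrcd_upto n Mx My hx hy \<tau> \<kappa> \<beta> U0 V0 Uh Vh U V \<Phi> \<Psi>" and n: "n \<ge> 1"
  shows "U n \<in> per_grid Mx My" "V n \<in> per_grid Mx My"
    "\<Phi> (n - 1) \<in> per_grid Mx My" "\<Psi> (n - 1) \<in> per_grid Mx My"
proof -
  have "U n \<in> per_grid Mx My \<and> V n \<in> per_grid Mx My \<and>
      \<Phi> (n - 1) \<in> per_grid Mx My \<and> \<Psi> (n - 1) \<in> per_grid Mx My"
  proof (cases "n = 1")
    case True
    then show ?thesis
      using run by (auto simp: lrcd_upto_def lrcd_step1_def lrcd_step2_def)
  next
    case False
    \<comment> \<open>Beyond the first level, the last data come from step 3 with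
      \<open>m = n - 1\<close>.\<close>
    with n have "1 \<le> n - 1 \<and> n - 1 < n" "n - 1 + 1 = n" by auto
    then show ?thesis
      using run unfolding lrcd_upto_def lrcd_step3_def by metis
  qed
  then show "U n \<in> per_grid Mx My" "V n \<in> per_grid Mx My"
    "\<Phi> (n - 1) \<in> per_grid Mx My" "\<Psi> (n - 1) \<in> per_grid Mx My" by auto
qed

text \<open>The new grids go to index \<open>n + 1\<close> but the potentials to index
  \<open>n\<close>, which stands for level \<open>n + 1/2\<close>. The earlier steps read none of
  these entries.\<close>

lemma lrcd_upto_Suc:
  assumes run: "lrcd_upto n Mx My hx hy \<tau> \<kappa> \<beta> U0 V0 Uh Vh U V \<Phi> \<Psi>" and n: "n \<ge> 1"
    and step: "lrcd_step3 Mx My hx hy \<tau> \<kappa> \<beta> (U n) (V n) (\<Phi> (n - 1)) (\<Psi> (n - 1)) U' V' \<Phi>' \<Psi>'"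
  shows "lrcd_upto (Suc n) Mx My hx hy \<tau> \<kappa> \<beta> U0 V0 Uh Vh
    (U(n + 1 := U')) (V(n + 1 := V')) (\<Phi>(n := \<Phi>')) (\<Psi>(n := \<Psi>'))"
  using run n step unfolding lrcd_upto_def by (auto simp: less_Suc_eq)

text \<open>Existence of runs shows that the uniqueness claims conditional on a run are not
  vacuous.\<close>

lemma lrcd_upto_ex:
  assumes hyps: "Mx > 0" "My > 0" "hx \<noteq> 0" "hy \<noteq> 0" "\<tau> \<noteq> 0"
    and UV: "U0 \<in> per_grid Mx My" "V0 \<in> per_grid Mx My" and n: "n \<ge> 1"
  shows "\<exists>Uh Vh U V \<Phi> \<Psi>. lrcd_upto n Mx My hx hy \<tau> \<kappa> \<beta> U0 V0 Uh Vh U V \<Phi> \<Psi>"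
  using n
proof (induction n rule: dec_induct)
  case base
  obtain Uh Vh \<Phi>h \<Psi>h where 1: "lrcd_step1 Mx My hx hy \<tau> \<kappa> \<beta> U0 V0 Uh Vh \<Phi>h \<Psi>h"
    using lrcd_step1_ex1[OF hyps UV, of \<kappa> \<beta>] by auto
  then have "\<Phi>h \<in> per_grid Mx My" "\<Psi>h \<in> per_grid Mx My"
    by (auto simp: lrcd_step1_def)
  from lrcd_step2_ex1[OF hyps UV this, of \<kappa> \<beta>]
  obtain U1 V1 where 2: "lrcd_step2 Mx My hx hy \<tau> \<kappa> \<beta> U0 V0 \<Phi>h \<Psi>h U1 V1" by auto
  \<comment> \<open>Entries beyond the first level are filled with arbitrary constants; no instance
    of step 3 occurs yet.\<close>
  have "lrcd_upto 1 Mx My hx hy \<tau> \<kappa> \<beta> U0 V0 Uh Vh (\<lambda>k. if k = 0 then U0 else U1)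
      (\<lambda>k. if k = 0 then V0 else V1) (\<lambda>_. \<Phi>h) (\<lambda>_. \<Psi>h)"
    using 1 2 by (simp add: lrcd_upto_def)
  then show ?case by blast
next
  case (step n)
  then obtain Uh Vh U V \<Phi> \<Psi> where
    run: "lrcd_upto n Mx My hx hy \<tau> \<kappa> \<beta> U0 V0 Uh Vh U V \<Phi> \<Psi>" by blast
  from lrcd_step3_ex1[OF hyps lrcd_upto_per_grid[OF run step(1)], of \<kappa> \<beta>] obtain U' V' \<Phi>' \<Psi>' where
    "lrcd_step3 Mx My hx hy \<tau> \<kappa> \<beta> (U n) (V n) (\<Phi> (n - 1)) (\<Psi> (n - 1)) U' V' \<Phi>' \<Psi>'" by auto
  from lrcd_upto_Suc[OF run step(1) this] show ?case by blast
qed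

theorem theorem2p8:
  fixes xl xr yl yr T \<kappa> \<beta> \<tau> hx hy :: real
    and N Mx My :: nat
    and u0 v0 :: "real \<Rightarrow> real \<Rightarrow> complex"
    and U0 V0 :: "complex grid"
  assumes "xl < xr" and "yl < yr" and "T > 0"
    and "N > 0" and "Mx > 0" and "My > 0"
    and "\<And>x y. u0 (x + (xr - xl)) y = u0 x y" and "\<And>x y. u0 x (y + (yr - yl)) = u0 x y"
    and "\<And>x y. v0 (x + (xr - xl)) y = v0 x y" and "\<And>x y. v0 x (y + (yr - yl)) = v0 x y"
  defines "\<tau> \<equiv> T / real N"
    and "hx \<equiv> (xr - xl) / real Mx"
    and "hy \<equiv> (yr - yl) / real My"
  defines "U0 \<equiv> grid_values xl yl hx hy u0"
    and "V0 \<equiv> grid_values xl yl hx hy v0"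
  shows
    "(\<exists>!(Uh, Vh, \<Phi>h, \<Psi>h). lrcd_step1 Mx My hx hy \<tau> \<kappa> \<beta> U0 V0 Uh Vh \<Phi>h \<Psi>h) \<and>
     (\<forall>Uh Vh \<Phi>h \<Psi>h. lrcd_step1 Mx My hx hy \<tau> \<kappa> \<beta> U0 V0 Uh Vh \<Phi>h \<Psi>h \<longrightarrow>
        (\<exists>!(U1, V1). lrcd_step2 Mx My hx hy \<tau> \<kappa> \<beta> U0 V0 \<Phi>h \<Psi>h U1 V1)) \<and>
     (\<forall>n\<in>{1..N - 1}. \<forall>Uh Vh U V \<Phi> \<Psi>.
        lrcd_upto n Mx My hx hy \<tau> \<kappa> \<beta> U0 V0 Uh Vh U V \<Phi> \<Psi> \<longrightarrow>
        (\<exists>!(U', V', \<Phi>', \<Psi>').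
           lrcd_step3 Mx My hx hy \<tau> \<kappa> \<beta> (U n) (V n) (\<Phi> (n - 1)) (\<Psi> (n - 1)) U' V' \<Phi>' \<Psi>')) \<and>
     (\<exists>Uh Vh U V \<Phi> \<Psi>. lrcd_upto N Mx My hx hy \<tau> \<kappa> \<beta> U0 V0 Uh Vh U V \<Phi> \<Psi>)"
proof -
  have hyps: "Mx > 0" "My > 0" "hx \<noteq> 0" "hy \<noteq> 0" "\<tau> \<noteq> 0"
    using assms(1-6) by (auto simp: hx_def hy_def \<tau>_def)
  have UV: "U0 \<in> per_grid Mx My" "V0 \<in> per_grid Mx My"
    unfolding U0_def V0_def hx_def hy_def
    by (intro per_grid_grid_values assms(5-10))+
  have step2: "\<exists>!(U1, V1). lrcd_step2 Mx My hx hy \<tau> \<kappa> \<beta> U0 V0 \<Phi>h \<Psi>h U1 V1"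
    if "lrcd_step1 Mx My hx hy \<tau> \<kappa> \<beta> U0 V0 Uh Vh \<Phi>h \<Psi>h" for Uh Vh \<Phi>h \<Psi>h
  proof -
    have "\<Phi>h \<in> per_grid Mx My" "\<Psi>h \<in> per_grid Mx My"
      using that unfolding lrcd_step1_def by blast+
    then show ?thesis by (rule lrcd_step2_ex1[OF hyps UV])
  qed
  have step3: "\<exists>!(U', V', \<Phi>', \<Psi>').
      lrcd_step3 Mx My hx hy \<tau> \<kappa> \<beta> (U n) (V n) (\<Phi> (n - 1)) (\<Psi> (n - 1)) U' V' \<Phi>' \<Psi>'"
    if "lrcd_upto n Mx My hx hy \<tau> \<kappa> \<beta> U0 V0 Uh Vh U V \<Phi> \<Psi>" "n \<ge> 1" for n Uh Vh U V \<Phi> \<Psi>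
    by (rule lrcd_step3_ex1[OF hyps lrcd_upto_per_grid[OF that]])
  have "N \<ge> 1" using assms(4) by simp
  then show ?thesis
    using lrcd_step1_ex1[OF hyps UV, of \<kappa> \<beta>] lrcd_upto_ex[OF hyps UV] step2 step3
    by (intro conjI allI impI ballI) (simp_all only: atLeastAtMost_iff)
qed

end
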